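(* Let $G$ be a finite simple graph that is triangle-free, $4$-sunspot-free, and $t$-sun-free for all integers $t\geq 5$. Then $\chi(G)\leq 47$.
   Context: Graphs are finite, without loops or parallel edges; $\chi(G)$ is the chromatic number. For an integer $t\geq 4$, a $t$-sun is the graph obtained from a $t$-vertex cycle by adding, for each vertex of the cycle, a new vertex of degree one adjacent to it. A $t$-sunspot is the graph obtained from a $t$-sun by deleting a single degree-one vertex. A graph is $t$-sun-free (resp. $t$-sunspot-free) if no induced subgraph of it is isomorphic to a $t$-sun (resp. $t$-sunspot). *)

theory Defs
  imports Complex_Main "Graph_Theory.Graph_Theory"
begin

text \<open>
  Finite simple graphs are rendered by the locale predicate \<^const>\<open>pair_graph\<close>: finitely many
  vertices, with the edge set represented as a symmetric irreflexive set of pairs of vertices.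
\<close>

definition proper_coloring :: "'a pair_pre_digraph \<Rightarrow> nat \<Rightarrow> ('a \<Rightarrow> nat) \<Rightarrow> bool" where
  "proper_coloring G k c \<longleftrightarrow>
     (\<forall>v \<in> pverts G. c v < k) \<and> (\<forall>(u, v) \<in> parcs G. c u \<noteq> c v)"

definition chromatic_number :: "'a pair_pre_digraph \<Rightarrow> nat" where
  "chromatic_number G = (LEAST k. \<exists>c. proper_coloring G k c)"

definition triangle_free :: "'a pair_pre_digraph \<Rightarrow> bool" where
  "triangle_free G \<longleftrightarrow>
     \<not> (\<exists>u v w. (u, v) \<in> parcs G \<and> (v, w) \<in> parcs G \<and> (u, w) \<in> parcs G)"

definition induced_free :: "'a pair_pre_digraph \<Rightarrow> 'b pair_pre_digraph \<Rightarrow> bool" where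
  "induced_free G F \<longleftrightarrow>
     \<not> (\<exists>H :: 'a pair_pre_digraph.
          induced_subgraph (with_proj H) (with_proj G) \<and>
          digraph_iso (with_proj H) (with_proj F))"

text \<open>
  The \<open>t\<close>-sun, used only for \<open>t \<ge> 4\<close>: the vertices \<open>Inl i\<close> form a cycle, and \<open>Inr i\<close> is the
  degree-one vertex attached to \<open>Inl i\<close>.
\<close>

definition sun :: "nat \<Rightarrow> (nat + nat) pair_pre_digraph" where
  "sun t =
     (let A = {(Inl i, Inl ((i + 1) mod t)) | i. i < t} \<union> {(Inl i, Inr i) | i. i < t}
      in \<lparr> pverts = {..<t} <+> {..<t}, parcs = A \<union> A\<inverse> \<rparr>)"

text \<open>
  By the rotational symmetry of the sun, deleting \<open>Inr 0\<close> gives, up to isomorphism, the same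
  graph as deleting any other degree-one vertex.
\<close>

definition sunspot :: "nat \<Rightarrow> (nat + nat) pair_pre_digraph" where
  "sunspot t =
     \<lparr> pverts = pverts (sun t) - {Inr 0},
       parcs = {(u, v) \<in> parcs (sun t). u \<noteq> Inr 0 \<and> v \<noteq> Inr 0} \<rparr>"

definition sun_free :: "nat \<Rightarrow> 'a pair_pre_digraph \<Rightarrow> bool" where
  "sun_free t G \<longleftrightarrow> induced_free G (sun t)"

definition sunspot_free :: "nat \<Rightarrow> 'a pair_pre_digraph \<Rightarrow> bool" where
  "sunspot_free t G \<longleftrightarrow> induced_free G (sunspot t)"

end

theory Submission
  imports Defs
begin

text \<open>
  Colour \<open>G\<close> level by level around a root of each component, with five colours per level and
  disjoint palettes for consecutive levels; ten colours suffice. Levels 0 and 1 are independent.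
  A vertex-minimal subset \<open>H\<close> of a later level that is not 5-colourable has minimum degree at
  least 5, and no two of its vertices have nested neighbourhoods. Every vertex of \<open>H\<close> has a
  parent \<open>x\<close>, and \<open>x\<close> has a neighbour \<open>p\<close> without neighbours in \<open>H\<close>. If two children of \<open>x\<close> in \<open>H\<close>
  had a common neighbour in \<open>H\<close>, then \<open>p\<close> would serve as a pendant of \<open>x\<close> in a 4-sunspot; and if
  \<open>H\<close> contained a 4-cycle, then parents would serve as pendants of its vertices. So \<open>H\<close> has girth
  at least 5, and by the degree condition a shortest cycle extends greedily to an induced sun.
\<close>

section \<open>Colouring of vertex sets, with two reductions to a smaller set\<close>

definition colourable :: "('a \<Rightarrow> 'a \<Rightarrow> bool) \<Rightarrow> 'a set \<Rightarrow> nat \<Rightarrow> bool" where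
  "colourable E S k \<longleftrightarrow>
     (\<exists>c. (\<forall>v\<in>S. c v < k) \<and> (\<forall>u\<in>S. \<forall>v\<in>S. E u v \<longrightarrow> c u \<noteq> (c v :: nat)))"

text \<open>The neighbours of \<open>v\<close> block fewer than \<open>k\<close> colours, so a free
  one is left for \<open>v\<close>.\<close>

lemma colourable_low_degree:
  assumes sym: "\<And>u v. E u v \<Longrightarrow> E v u" and irr: "\<And>u. \<not> E u u"
    and fin: "finite S" and v: "v \<in> S" and deg: "card {w\<in>S. E v w} < k"
    and col: "colourable E (S - {v}) k"
  shows "colourable E S k"
proof -
  obtain c where c: "\<forall>u\<in>S - {v}. c u < k"
      "\<forall>u\<in>S - {v}. \<forall>w\<in>S - {v}. E u w \<longrightarrow> c u \<noteq> (c w :: nat)"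
    using col unfolding colourable_def by blast
  have "card (c ` {w\<in>S. E v w}) < card {..<k}"
    using card_image_le[of "{w\<in>S. E v w}" c] fin deg by simp
  then have "\<not> {..<k} \<subseteq> c ` {w\<in>S. E v w}"
    using card_mono[of "c ` {w\<in>S. E v w}" "{..<k}"] fin by auto
  then obtain x where x: "x < k" "x \<notin> c ` {w\<in>S. E v w}" by auto
  show ?thesis unfolding colourable_def
    by (rule exI[of _ "c(v := x)"]) (use c x sym irr in \<open>auto simp: image_iff; metis\<close>)
qed

text \<open>\<open>u\<close> copies the colour of \<open>v\<close>, which all neighbours of
  \<open>u\<close> avoid since they are neighbours of \<open>v\<close> too. The two are not
  adjacent, as domination would then put a loop at \<open>v\<close>.\<close>

lemma colourable_dominated:
  assumes sym: "\<And>u v. E u v \<Longrightarrow> E v u" and irr: "\<And>u. \<not> E u u"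
    and uv: "u \<in> S" "v \<in> S" "u \<noteq> v" and dom: "\<And>w. w \<in> S \<Longrightarrow> E u w \<Longrightarrow> E v w"
    and col: "colourable E (S - {u}) k"
  shows "colourable E S k"
proof -
  obtain c where c: "\<forall>w\<in>S - {u}. c w < k"
      "\<forall>w\<in>S - {u}. \<forall>z\<in>S - {u}. E w z \<longrightarrow> c w \<noteq> (c z :: nat)"
    using col unfolding colourable_def by blast
  show ?thesis unfolding colourable_def
    by (rule exI[of _ "c(u := c v)"])
      (use c uv dom sym irr in \<open>auto; metis insertE insert_Diff\<close>)
qed

text \<open>
  In \<open>spot\<close>, triangle-freeness rules out all adjacencies that are not mentioned, so the seven
  vertices induce a 4-sunspot unless two of the pendants \<open>p\<close>, \<open>q\<close>, \<open>r\<close> are adjacent.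
\<close>

locale spot_sun_free =
  fixes E :: "'a \<Rightarrow> 'a \<Rightarrow> bool"
  assumes sym: "E u v \<Longrightarrow> E v u"
    and triangle: "E u v \<Longrightarrow> E v w \<Longrightarrow> \<not> E u w"
    and spot: "\<lbrakk>E a b; E b c; E c d; E d a; E p a; \<not> E p c; E q c; \<not> E q a; E r b; \<not> E r d\<rbrakk>
      \<Longrightarrow> E p q \<or> E p r \<or> E q r"
    and no_sun: "\<And>(n :: nat) (c :: nat \<Rightarrow> 'a) (u :: nat \<Rightarrow> 'a).
      \<lbrakk>5 \<le> n;
      \<And>i j. i < n \<Longrightarrow> j < n \<Longrightarrow> E (c i) (c j) \<longleftrightarrow> j = Suc i mod n \<or> i = Suc j mod n;
      \<And>i j. i < n \<Longrightarrow> j < n \<Longrightarrow> E (c i) (u j) \<longleftrightarrow> i = j;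
      \<And>i j. i < n \<Longrightarrow> j < n \<Longrightarrow> \<not> E (u i) (u j)\<rbrakk> \<Longrightarrow> False"
begin

lemma irrefl: "\<not> E u u"
  using triangle by blast

lemma sym_iff: "E u v \<longleftrightarrow> E v u"
  using sym by blast

end

section \<open>Four-cycles in a critical subset of a level\<close>

text \<open>\<open>degree\<close> and \<open>undominated\<close> say that neither reduction applies;
  \<open>parent\<close> is inherited from the two preceding levels. The set may be empty, so that
  the analysis can end in \<open>H = {}\<close>.\<close>

locale undominated_level = spot_sun_free +
  fixes H :: "'a set"
  assumes finite_H: "finite H"
    and undominated: "u \<in> H \<Longrightarrow> v \<in> H \<Longrightarrow> u \<noteq> v \<Longrightarrow> \<exists>w\<in>H. E u w \<and> \<not> E v w"
    and degree: "v \<in> H \<Longrightarrow> 5 \<le> card {w\<in>H. E v w}"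
    and parent: "v \<in> H \<Longrightarrow> \<exists>x p. E x v \<and> E p x \<and> (\<forall>h\<in>H. \<not> E p h)"
begin

text \<open>In the 4-cycle \<open>b\<close>, \<open>x\<close>, \<open>d\<close>, \<open>c\<close>,
  the pendants are \<open>r\<close> at \<open>b\<close>, \<open>s\<close> at \<open>d\<close> and
  \<open>p\<close> at \<open>x\<close>. Since \<open>p\<close> sees nothing in \<open>H\<close>, the
  edge forced by \<open>spot\<close> can only join \<open>r\<close> and \<open>s\<close>.\<close>

lemma siblings_tight:
  assumes "E p x" "\<forall>h\<in>H. \<not> E p h" "b \<in> H" "d \<in> H" "c \<in> H" "E x b" "E x d" "E c b" "E c d"
    and "r \<in> H" "E b r" "\<not> E d r" "s \<in> H" "E d s" "\<not> E b s"
  shows "E r s"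
  using spot[of b x d c r s p] assms by (auto simp: sym_iff)

text \<open>By \<open>siblings_tight\<close>, private neighbours of two such siblings are adjacent;
  three siblings have enough of them to form a triangle.\<close>

lemma no_three_siblings:
  assumes x: "E p x" "\<forall>h\<in>H. \<not> E p h" and c: "c \<in> H"
    and H: "b \<in> H" "d \<in> H" "e \<in> H" and ne: "b \<noteq> d" "d \<noteq> e" "b \<noteq> e"
    and xE: "E x b" "E x d" "E x e" and cE: "E c b" "E c d" "E c e"
  shows False
proof -
  define P where "P b \<longleftrightarrow> b \<in> H \<and> E x b \<and> E c b" for b
  have P: "P b" "P d" "P e" using H xE cE by (auto simp: P_def)
  have T: "E r s" if "P b" "P d" "r \<in> H" "E b r" "\<not> E d r" "s \<in> H" "E d s" "\<not> E b s" for b d r s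
    by (rule siblings_tight[OF x, of b d c]) (use that c in \<open>auto simp: P_def\<close>)
  \<comment> \<open>\<open>T\<close> makes \<open>y\<close> and \<open>z\<close> adjacent, and
    \<open>b1\<close> completes a triangle. Hence at most one pair among three siblings has a common
    neighbour that the third misses.\<close>
  have no2: False if "P b2" "P b3" "y \<in> H" "z \<in> H"
      "E b1 y" "E b2 y" "\<not> E b3 y" "E b1 z" "E b3 z" "\<not> E b2 z" for b1 b2 b3 y z
    using T[of b2 b3 y z] triangle[of b1 y z] that by simp
  \<comment> \<open>Here only the pair \<open>b1\<close>, \<open>b2\<close> may have such a
    neighbour. Each sibling then has a neighbour missed by both others, and these three are pairwise
    adjacent.\<close>
  have main: False
    if B: "P b1" "P b2" "P b3" and ne: "b1 \<noteq> b2" "b2 \<noteq> b3" "b1 \<noteq> b3"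
      and n13: "\<And>y. y \<in> H \<Longrightarrow> E b1 y \<Longrightarrow> E b3 y \<Longrightarrow> E b2 y"
      and n23: "\<And>y. y \<in> H \<Longrightarrow> E b2 y \<Longrightarrow> E b3 y \<Longrightarrow> E b1 y" for b1 b2 b3
  proof -
    have B': "b1 \<in> H" "b2 \<in> H" "b3 \<in> H" using B by (auto simp: P_def)
    obtain y1 where y1: "y1 \<in> H" "E b1 y1" "\<not> E b2 y1"
      using undominated[of b1 b2] B' ne by auto
    obtain y2 where y2: "y2 \<in> H" "E b2 y2" "\<not> E b1 y2"
      using undominated[of b2 b1] B' ne by auto
    obtain y3 where y3: "y3 \<in> H" "E b3 y3" "\<not> E b1 y3"
      using undominated[of b3 b1] B' ne by auto
    have "\<not> E b3 y1" "\<not> E b3 y2" "\<not> E b2 y3"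
      using n13[of y1] n23[of y2] n23[of y3] y1 y2 y3 by auto
    then have "E y1 y2" "E y2 y3" "E y1 y3"
      using T[of b1 b2 y1 y2] T[of b2 b3 y2 y3] T[of b1 b3 y1 y3] B y1 y2 y3 by auto
    then show False using triangle by blast
  qed
  show False
  proof (cases "\<exists>y\<in>H. E b y \<and> E d y \<and> \<not> E e y")
    case True
    then obtain y where y: "y \<in> H" "E b y" "E d y" "\<not> E e y" by blast
    show False
    proof (rule main[of b d e])
      show "E d z" if "z \<in> H" "E b z" "E e z" for z
        using no2[of d e y z b] P y that by auto
      show "E b z" if "z \<in> H" "E d z" "E e z" for z
        using no2[of b e y z d] P y that by auto
    qed (use P ne in auto)
  next
    case n1: False
    show False
    proof (cases "\<exists>y\<in>H. E b y \<and> E e y \<and> \<not> E d y")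
      case True
      then obtain y where y: "y \<in> H" "E b y" "E e y" "\<not> E d y" by blast
      show False
      proof (rule main[of b e d])
        show "E b z" if "z \<in> H" "E e z" "E d z" for z
          using no2[of b d y z e] P y that by auto
      qed (use P ne n1 in auto)
    next
      case False
      show False
        by (rule main[of d e b]) (use P ne n1 False in auto)
    qed
  qed
qed

text \<open>The degree bound gives \<open>c\<close> a third neighbour \<open>q\<close>, which is not
  a child of \<open>x\<close>. With \<open>p\<close> at \<open>x\<close> and \<open>q\<close> at
  \<open>c\<close> as pendants of the cycle \<open>x\<close>, \<open>b\<close>, \<open>c\<close>,
  \<open>d\<close>, private neighbours \<open>r\<close> of \<open>b\<close> and \<open>s\<close> of
  \<open>d\<close> must both be adjacent to \<open>q\<close>. By \<open>siblings_tight\<close> they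
  are adjacent to each other, a triangle.\<close>

lemma no_two_siblings:
  assumes x: "E p x" "\<forall>h\<in>H. \<not> E p h" and c: "c \<in> H" and H: "b \<in> H" "d \<in> H" "b \<noteq> d"
    and xE: "E x b" "E x d" and cE: "E c b" "E c d"
  shows False
proof -
  obtain r where r: "r \<in> H" "E b r" "\<not> E d r" using undominated[of b d] H by auto
  obtain s where s: "s \<in> H" "E d s" "\<not> E b s" using undominated[of d b] H by auto
  have "\<not> {w\<in>H. E c w} \<subseteq> {b, d}"
  proof
    assume "{w\<in>H. E c w} \<subseteq> {b, d}"
    then have "card {w\<in>H. E c w} \<le> card {b, d}" by (intro card_mono) auto
    then show False using degree[OF c] H by simp
  qed
  then obtain q where q: "q \<in> H" "E c q" "q \<noteq> b" "q \<noteq> d" by blast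
  have "\<not> E x q" using no_three_siblings[OF x c, of b d q] q H xE cE by auto
  then have "E q r" "E q s"
    using spot[of x b c d p q r] spot[of x d c b p q s] x c q r s xE cE H
    by (auto simp: sym_iff)
  moreover have "E r s" by (rule siblings_tight[OF x, of b d c]) (use r s c H xE cE in auto)
  ultimately show False using triangle by blast
qed

lemma no_four_cycle:
  assumes H: "a \<in> H" "b \<in> H" "c \<in> H" "d \<in> H" and ne: "a \<noteq> c" "b \<noteq> d"
    and C: "E a b" "E b c" "E c d" "E d a"
  shows False
proof -
  \<comment> \<open>Each of \<open>c\<close>, \<open>r\<close>, \<open>s\<close> has a common
    neighbour with \<open>a\<close> in \<open>H\<close>, namely \<open>b\<close> or
    \<open>d\<close>, so it cannot be a sibling of \<open>a\<close>.\<close>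
  have unshared: "\<not> E x c" "\<not> E x r" "\<not> E x s"
    if x: "E p x" "\<forall>h\<in>H. \<not> E p h" and xa: "E x a"
      and H: "a \<in> H" "b \<in> H" "c \<in> H" "d \<in> H" and ne: "a \<noteq> c"
      and C: "E a b" "E b c" "E c d" "E d a"
      and r: "r \<in> H" "E b r" "\<not> E d r" and s: "s \<in> H" "E d s" "\<not> E b s"
    for a b c d r s x p
  proof -
    have "a \<noteq> r" "a \<noteq> s" using C r s by (auto simp: sym_iff)
    then show "\<not> E x c" "\<not> E x r" "\<not> E x s"
      using no_two_siblings[OF x, of b a c] no_two_siblings[OF x, of b a r]
        no_two_siblings[OF x, of d a s] H ne C r s xa by (auto simp: sym_iff)
  qed
  \<comment> \<open>The parent \<open>x\<close> of \<open>a\<close> is the third pendant; it is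
    adjacent to neither \<open>r\<close> nor \<open>s\<close>.\<close>
  have key: "E r s"
    if H: "a \<in> H" "b \<in> H" "c \<in> H" "d \<in> H" and ne: "a \<noteq> c"
      and C: "E a b" "E b c" "E c d" "E d a"
      and r: "r \<in> H" "E b r" "\<not> E d r" and s: "s \<in> H" "E d s" "\<not> E b s" for a b c d r s
  proof -
    obtain x p where x: "E p x" "\<forall>h\<in>H. \<not> E p h" and xa: "E x a"
      using parent[OF H(1)] by auto
    show ?thesis
      using unshared[OF x xa H ne C r s] spot[of b a d c r s x] C r s xa by (auto simp: sym_iff)
  qed
  obtain p where p: "p \<in> H" "E a p" "\<not> E c p" using undominated[of a c] H ne by auto
  obtain q where q: "q \<in> H" "E c q" "\<not> E a q" using undominated[of c a] H ne by auto
  obtain r where r: "r \<in> H" "E b r" "\<not> E d r" using undominated[of b d] H ne by auto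
  obtain s where s: "s \<in> H" "E d s" "\<not> E b s" using undominated[of d b] H ne by auto
  have rs: "E r s" by (rule key[of a b c d]) (use H ne C r s in auto)
  \<comment> \<open>The same cycle read from \<open>b\<close>. This edge makes \<open>p\<close> a
    common neighbour of \<open>a\<close> and \<open>q\<close>, so that no parent of \<open>a\<close>
    is adjacent to \<open>q\<close>.\<close>
  have pq: "E p q" by (rule key[of b a d c]) (use H ne C p q in \<open>auto simp: sym\<close>)
  obtain x y where x: "E y x" "\<forall>h\<in>H. \<not> E y h" and xa: "E x a"
    using parent[OF H(1)] by auto
  have "a \<noteq> q" using triangle[of a b c] C q sym by blast
  then have "\<not> E x q" using no_two_siblings[OF x, of p a q] H p q pq xa by (auto simp: sym_iff)
  then have "E q r" "E q s"
    using unshared[OF x xa H ne(1) C r s] spot[of a b c d x q r] spot[of a d c b x q s] C q r s xa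
    by (auto simp: sym_iff)
  then show False using rs triangle by blast
qed

end

section \<open>Closed walks without backtracking, and a shortest cycle\<close>

context undominated_level
begin

text \<open>Backtracking is excluded only away from the base point, so that subwalks stay admissible.\<close>

definition closed_walk :: "nat \<Rightarrow> (nat \<Rightarrow> 'a) \<Rightarrow> bool" where
  "closed_walk n w \<longleftrightarrow> 1 \<le> n \<and> w 0 = w n \<and> (\<forall>i\<le>n. w i \<in> H) \<and>
     (\<forall>i<n. E (w i) (w (Suc i))) \<and> (\<forall>i. i + 2 \<le> n \<longrightarrow> w i \<noteq> w (i + 2))"

lemma another_neighbour:
  assumes "v \<in> H"
  shows "\<exists>t\<in>H. E v t \<and> t \<noteq> u"
proof (rule ccontr)
  assume "\<not> ?thesis"
  then have "{w\<in>H. E v w} \<subseteq> {u}" by blast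
  then have "card {w\<in>H. E v w} \<le> card {u}" by (intro card_mono) auto
  then show False using degree[OF assms] by simp
qed

text \<open>A walk can always continue without backtracking, and in a finite set it must revisit a
  vertex.\<close>

lemma ex_closed_walk:
  assumes "H \<noteq> {}"
  shows "\<exists>n w. closed_walk n w"
proof -
  define f where "f u v = (SOME t. t \<in> H \<and> E v t \<and> t \<noteq> u)" for u v
  have f: "f u v \<in> H" "E v (f u v)" "f u v \<noteq> u" if "v \<in> H" for u v
    using someI_ex[of "\<lambda>t. t \<in> H \<and> E v t \<and> t \<noteq> u"] another_neighbour[OF that, of u]
    unfolding f_def by blast+
  obtain a where a: "a \<in> H" using assms by blast
  \<comment> \<open>The state holds two consecutive vertices, because the next one must differ from
    the one before last.\<close>
  define g where "g n = ((\<lambda>(u, v). (v, f u v)) ^^ n) (a, f a a)" for n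
  define w where "w n = fst (g n)" for n
  have g_Suc: "g (Suc n) = (snd (g n), f (fst (g n)) (snd (g n)))" for n
    by (simp add: g_def case_prod_beta)
  have inv: "fst (g n) \<in> H \<and> snd (g n) \<in> H \<and> E (fst (g n)) (snd (g n))" for n
  proof (induction n)
    case 0
    show ?case using a f[OF a] by (simp add: g_def)
  next
    case (Suc n)
    then show ?case using f[of "snd (g n)"] by (simp add: g_Suc)
  qed
  have w: "w n \<in> H" "E (w n) (w (Suc n))" "w n \<noteq> w (n + 2)" for n
  proof -
    show "w n \<in> H" "E (w n) (w (Suc n))" using inv[of n] by (auto simp: w_def g_Suc)
    show "w n \<noteq> w (n + 2)"
      using f(3)[of "snd (g n)" "fst (g n)"] inv[of n] by (auto simp: w_def g_Suc)
  qed
  have "\<not> inj w"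
    using finite_imageD[of w UNIV] finite_subset[OF _ finite_H, of "range w"] w(1) by auto
  then obtain i j where "w i = w j" "i < j"
    unfolding inj_def by (metis nat_neq_iff)
  then have "closed_walk (j - i) (\<lambda>k. w (i + k))"
    using w by (auto simp: closed_walk_def)
  then show ?thesis by blast
qed

end

text \<open>Minimality ranges over closed walks instead of cycles, so shortcuts need no check for
  repeated vertices; \<open>w_inj\<close> recovers a cycle.\<close>

locale shortest_walk = undominated_level +
  fixes n :: nat and w :: "nat \<Rightarrow> 'a"
  assumes walk: "closed_walk n w"
    and shortest: "closed_walk m w' \<Longrightarrow> n \<le> m"
begin

lemma w_H: "i \<le> n \<Longrightarrow> w i \<in> H"
  using walk by (auto simp: closed_walk_def)

lemma w_step: "i < n \<Longrightarrow> E (w i) (w (Suc i))"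
  using walk by (auto simp: closed_walk_def)

lemma w_nb: "i + 2 \<le> n \<Longrightarrow> w i \<noteq> w (i + 2)"
  using walk unfolding closed_walk_def by blast

lemma w_closed: "w 0 = w n" and n_pos: "0 < n"
  using walk by (auto simp: closed_walk_def)

lemma n_ge_5: "5 \<le> n"
proof (rule ccontr)
  assume "\<not> 5 \<le> n"
  then consider "n = 1" | "n = 2" | "n = 3" | "n = 4" using n_pos by linarith
  then show False
  proof cases
    case 1
    then show False using w_step[of 0] w_closed irrefl by simp
  next
    case 2
    then show False using w_nb[of 0] w_closed by (simp add: numeral_2_eq_2)
  next
    case 3
    then have "E (w 0) (w 1)" "E (w 1) (w 2)" "E (w 2) (w 0)"
      using w_step[of 0] w_step[of 1] w_step[of 2] w_closed by (auto simp: numeral_eq_Suc)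
    then show False using triangle sym by blast
  next
    case 4
    then have "E (w 0) (w 1)" "E (w 1) (w 2)" "E (w 2) (w 3)" "E (w 3) (w 0)"
      using w_step[of 0] w_step[of 1] w_step[of 2] w_step[of 3] w_closed
      by (auto simp: numeral_eq_Suc)
    moreover have "w 0 \<noteq> w 2" "w 1 \<noteq> w 3"
      using w_nb[of 0] w_nb[of 1] 4 by (auto simp: numeral_eq_Suc)
    ultimately show False
      using no_four_cycle[of "w 0" "w 1" "w 2" "w 3"] w_H 4 by auto
  qed
qed

text \<open>The stretch between two visits to a vertex would be a shorter closed walk.\<close>

lemma w_inj:
  assumes "i < n" "j < n" "w i = w j"
  shows "i = j"
proof -
  have "\<not> i < j" if "j < n" "w i = w j" for i j
  proof
    assume "i < j"
    have "closed_walk (j - i) (\<lambda>k. w (i + k))"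
      unfolding closed_walk_def
      using \<open>i < j\<close> that w_H w_step w_nb by (auto simp flip: add.assoc)
    then show False using shortest[of "j - i"] \<open>i < j\<close> that by fastforce
  qed
  then show ?thesis using assms by (metis nat_neq_iff)
qed

text \<open>Cyclic indexing lets arcs run past the base point.\<close>

definition d :: "nat \<Rightarrow> 'a" where
  "d i = w (i mod n)"

lemma d_H: "d i \<in> H"
  using w_H[of "i mod n"] n_pos by (simp add: d_def less_imp_le)

lemma d_eq_iff: "d i = d j \<longleftrightarrow> i mod n = j mod n"
  using w_inj n_pos by (auto simp: d_def)

lemma d_add_n: "d (i + n) = d i"
  by (simp add: d_def)

lemma d_step: "E (d i) (d (Suc i))"
proof -
  have "i mod n < n" using n_pos by simp
  then show ?thesis
    using w_step[of "i mod n"] w_closed by (auto simp: d_def mod_Suc)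
qed

lemma d_neq:
  assumes "0 < k" "k < n"
  shows "d i \<noteq> d (i + k)"
proof
  assume "d i = d (i + k)"
  then have "n dvd (i + k) - i"
    using mod_eq_dvd_iff_nat[of i "i + k" n] by (simp add: d_eq_iff)
  then show False using assms by (auto dest: dvd_imp_le)
qed

lemma no_chord:
  assumes "2 \<le> k" "k + 2 \<le> n" "E (d i) (d (i + k))"
  shows False
proof -
  \<comment> \<open>The arc from \<open>d i\<close> to \<open>d (i + k)\<close>, with the chord as
    step number \<open>k + 1\<close>.\<close>
  define W where "W t = (if t \<le> k then d (i + t) else d i)" for t
  have "closed_walk (k + 1) W"
    unfolding closed_walk_def
  proof (intro conjI allI impI)
    show "E (W t) (W (Suc t))" if "t < k + 1" for t
      using that assms d_step[of "i + t"] sym by (auto simp: W_def not_le less_Suc_eq)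
    show "W t \<noteq> W (t + 2)" if "t + 2 \<le> k + 1" for t
    proof (cases "t + 2 \<le> k")
      case True
      then show ?thesis using d_neq[of 2 "i + t"] assms by (auto simp: W_def)
    next
      case False
      then have "t = k - 1" "k - 1 < n" using that assms by auto
      then show ?thesis using d_neq[of "k - 1" i] assms by (auto simp: W_def)
    qed
  qed (use d_H in \<open>auto simp: W_def\<close>)
  then show False using shortest assms by fastforce
qed

lemma cycle_adjacency:
  assumes "i < n" "j < n"
  shows "E (d i) (d j) \<longleftrightarrow> j = Suc i mod n \<or> i = Suc j mod n"
proof -
  have *: "E (d i) (d j) \<longleftrightarrow> j = Suc i mod n \<or> i = Suc j mod n" if "i < j" "j < n" for i j
  proof -
    consider "j = Suc i" | "i = 0" "j = n - 1" | "j - i \<ge> 2" "(j - i) + 2 \<le> n"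
      using \<open>i < j\<close> \<open>j < n\<close> by atomize_elim arith
    then show ?thesis
    proof cases
      case 1
      then show ?thesis using d_step[of i] that by simp
    next
      case 2
      then show ?thesis using d_step[of j] d_add_n[of 0] that sym by simp
    next
      case 3
      then have "\<not> E (d i) (d j)" using no_chord[of "j - i" i] that by auto
      moreover have "j \<noteq> Suc i mod n" "i \<noteq> Suc j mod n"
        using 3 that by (auto simp: mod_Suc)
      ultimately show ?thesis by blast
    qed
  qed
  consider "i < j" | "i = j" | "j < i" by linarith
  then show ?thesis
  proof cases
    case 1
    then show ?thesis using * assms by blast
  next
    case 2
    then show ?thesis using irrefl n_ge_5 assms by (auto simp: mod_Suc)
  next
    case 3
    then show ?thesis using *[of j i] assms sym_iff[of "d i" "d j"] by blast
  qed
qed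

text \<open>The closed walk from \<open>u\<close> along the arc to \<open>v\<close> and back to
  \<open>u\<close> has length \<open>k + 3\<close>, less than \<open>n\<close>.\<close>

lemma no_detour:
  assumes u: "u \<in> H" "u \<notin> range d" and v: "v \<in> H" "v \<notin> range d"
    and uv: "E (d i) u" "E (d (i + k)) v" "E u v" and k: "0 < k" "k + 3 < n"
  shows False
proof -
  define W where "W t = (if t = 0 then u else if t \<le> k + 1 then d (i + t - 1)
    else if t = k + 2 then v else u)" for t
  have nd: "u \<noteq> d j" "v \<noteq> d j" for j using u v by auto
  have "closed_walk (k + 3) W"
    unfolding closed_walk_def
  proof (intro conjI allI impI)
    show "E (W t) (W (Suc t))" if "t < k + 3" for t
    proof -
      consider "t = 0" | "0 < t" "t < k + 1" | "t = k + 1" | "t = k + 2"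
        using \<open>t < k + 3\<close> by atomize_elim arith
      then show ?thesis
        by cases (use uv d_step[of "i + t - 1"] in \<open>auto simp: W_def sym\<close>)
    qed
    show "W t \<noteq> W (t + 2)" if "t + 2 \<le> k + 3" for t
    proof -
      consider "t = 0" | "0 < t" "t + 2 \<le> k + 1" | "t = k" | "t = k + 1"
        using \<open>t + 2 \<le> k + 3\<close> by atomize_elim arith
      then show ?thesis
        by cases (use nd nd[symmetric] k d_neq[of 2 "i + t - 1"] in \<open>auto simp: W_def\<close>)
    qed
  qed (use u v d_H in \<open>auto simp: W_def\<close>)
  then show False using shortest k by fastforce
qed

lemma no_short_ear:
  assumes u: "u \<in> H" "u \<notin> range d" and uv: "E (d i) u" "E (d (i + k)) u" and k: "0 < k" "k + 2 < n"
  shows False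
proof -
  define W where "W t = (if t = 0 then u else if t \<le> k + 1 then d (i + t - 1) else u)" for t
  have nd: "u \<noteq> d j" for j using u by auto
  have "closed_walk (k + 2) W"
    unfolding closed_walk_def
  proof (intro conjI allI impI)
    show "E (W t) (W (Suc t))" if "t < k + 2" for t
    proof -
      consider "t = 0" | "0 < t" "t < k + 1" | "t = k + 1"
        using \<open>t < k + 2\<close> by atomize_elim arith
      then show ?thesis
        by cases (use uv d_step[of "i + t - 1"] in \<open>auto simp: W_def sym\<close>)
    qed
    show "W t \<noteq> W (t + 2)" if "t + 2 \<le> k + 2" for t
    proof -
      consider "t = 0" | "0 < t" "t + 2 \<le> k + 1" | "t = k"
        using \<open>t + 2 \<le> k + 2\<close> by atomize_elim arith
      then show ?thesis
        by cases (use nd nd[symmetric] k d_neq[of 2 "i + t - 1"] in \<open>auto simp: W_def\<close>)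
    qed
  qed (use u d_H in \<open>auto simp: W_def\<close>)
  then show False using shortest k by fastforce
qed

text \<open>Two attachments cut the cycle into two arcs. As \<open>n\<close> is at least 5, one of
  them has length below \<open>n - 2\<close> and gives a short ear.\<close>

lemma unique_attachment:
  assumes u: "u \<in> H" "u \<notin> range d" and "i < n" "j < n" "E (d i) u" "E (d j) u"
  shows "i = j"
proof -
  have "\<not> i < j" if ij: "i < n" "j < n" "E (d i) u" "E (d j) u" for i j
  proof
    assume "i < j"
    then consider "j - i + 2 < n" | "i + n - j + 2 < n" using ij n_ge_5 by linarith
    then show False
    proof cases
      case 1
      then show False using no_short_ear[OF u, of i "j - i"] ij \<open>i < j\<close> by simp
    next
      case 2
      then show False
        using no_short_ear[OF u, of j "i + n - j"] ij \<open>i < j\<close> d_add_n[of i] by simp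
    qed
  qed
  then show ?thesis using assms by (metis nat_neq_iff)
qed

section \<open>Completing a shortest cycle to an induced sun\<close>

text \<open>Greedy choice: of at least five neighbours of \<open>d m\<close> in \<open>H\<close>, at
  most two lie on the cycle and at most two more are excluded by earlier pendants.\<close>

lemma pendants:
  assumes "m \<le> n"
  shows "\<exists>u. \<forall>i<m. u i \<in> H \<and> E (d i) (u i) \<and> u i \<notin> range d \<and> (\<forall>j<i. \<not> E (u j) (u i))"
  using assms
proof (induction m)
  case 0
  show ?case by simp
next
  case (Suc m)
  then obtain u where u: "u i \<in> H" "E (d i) (u i)" "u i \<notin> range d" "\<forall>j<i. \<not> E (u j) (u i)"
    if "i < m" for i by (metis Suc_leD)
  \<comment> \<open>\<open>m + n - 1\<close> indexes the cyclic predecessor of \<open>d m\<close>,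
    also when \<open>m = 0\<close>.\<close>
  define A where "A = {v\<in>H. E (d m) v} - {d (Suc m), d (m + n - 1)}"
  define B where "B = (\<Union>j\<in>{j. j < m \<and> (j + 2 = m \<or> j + 3 = m)}. {v\<in>A. E (u j) v})"
  have finA: "finite A" using finite_H by (simp add: A_def)
  have "card {v\<in>H. E (d m) v} - card {d (Suc m), d (m + n - 1)} \<le> card A"
    unfolding A_def by (rule diff_card_le_card_Diff) simp
  moreover have "card {d (Suc m), d (m + n - 1)} \<le> 2"
    by (rule order_trans[OF card_insert_le_m1]) auto
  ultimately have card_A: "3 \<le> card A" using degree[OF d_H[of m]] by linarith
  \<comment> \<open>By minimality only the pendants of the second and third last vertex can conflict with a new one,
    and each of them excludes at most one candidate because there are no 4-cycles.\<close>
  have le1: "card {v\<in>A. E (u j) v} \<le> 1" if "j < m" for j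
  proof -
    have "x = y" if xy: "x \<in> A" "y \<in> A" "E (u j) x" "E (u j) y" for x y
      using no_four_cycle[of "u j" x "d m" y] u[OF \<open>j < m\<close>] xy d_H[of m] sym
      unfolding A_def by auto
    then show ?thesis using finA by (subst card_le_Suc0_iff_eq[unfolded One_nat_def[symmetric]]) auto
  qed
  \<comment> \<open>For small \<open>m\<close>, truncated subtraction can add the index 0, which
    only enlarges the bound; intersecting with \<open>{..<m}\<close> keeps \<open>le1\<close>
    applicable.\<close>
  have "B \<subseteq> (\<Union>j\<in>{m - 2, m - 3} \<inter> {..<m}. {v\<in>A. E (u j) v})"
    unfolding B_def by (auto simp: numeral_eq_Suc)
  then have "card B \<le> card (\<Union>j\<in>{m - 2, m - 3} \<inter> {..<m}. {v\<in>A. E (u j) v})"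
    using finA by (intro card_mono) auto
  also have "\<dots> \<le> (\<Sum>j\<in>{m - 2, m - 3} \<inter> {..<m}. card {v\<in>A. E (u j) v})"
    by (rule card_UN_le) simp
  also have "\<dots> \<le> (\<Sum>j\<in>{m - 2, m - 3} \<inter> {..<m}. 1)"
    by (rule sum_mono) (use le1 in auto)
  also have "\<dots> \<le> card {m - 2, m - 3}"
    by (simp add: card_mono)
  also have "\<dots> \<le> 2" by (rule order_trans[OF card_insert_le_m1]) auto
  finally have "\<not> A \<subseteq> B"
    using card_A card_mono[of B A] finA by (auto simp: B_def)
  then obtain v where v: "v \<in> A" "v \<notin> B" by blast
  have vH: "v \<in> H" "E (d m) v" using v by (auto simp: A_def)
  have off: "v \<notin> range d"
  proof
    assume "v \<in> range d"
    then obtain j where j: "j < n" "v = d j"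
      using n_pos by (auto simp: d_def) (metis mod_less_divisor mod_mod_trivial)
    then have "j = Suc m mod n \<or> m = Suc j mod n"
      using cycle_adjacency[of m j] vH Suc.prems by simp
    then have "v = d (Suc m) \<or> v = d (m + n - 1)"
    proof
      assume "j = Suc m mod n"
      then show ?thesis using j by (simp add: d_def)
    next
      assume "m = Suc j mod n"
      then have "j = (m + n - 1) mod n"
        using j by (cases "Suc j = n") auto
      then show ?thesis using j by (simp add: d_def)
    qed
    then show False using v by (simp add: A_def)
  qed
  have nonadj: "\<not> E (u j) v" if "j < m" for j
  proof
    assume e: "E (u j) v"
    have "j + 2 \<noteq> m" "j + 3 \<noteq> m" using e v that by (auto simp: B_def)
    \<comment> \<open>Distance 1 along the cycle gives a closed walk of length 4, and for distance
      at least 4 the complementary arc is short enough. Only distances 2 and 3 can escape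
      both.\<close>
    then consider "m - j + 3 < n" | "n - (m - j) + 3 < n" using n_ge_5 that Suc.prems by linarith
    then show False
    proof cases
      case 1
      then show False
        using no_detour[of "u j" v j "m - j"] u[OF that] vH off e that by simp
    next
      case 2
      have "m + (n - (m - j)) = j + n" using that Suc.prems by linarith
      then have "d (m + (n - (m - j))) = d j" by (simp only: d_add_n)
      then show False
        by (intro no_detour[of v "u j" m "n - (m - j)"])
          (use u[OF that] vH off sym[OF e] that 2 Suc.prems in auto)
    qed
  qed
  show ?case
    by (rule exI[of _ "u(m := v)"]) (use u vH off nonadj in \<open>auto simp: less_Suc_eq\<close>)
qed

lemma contradiction: False
proof -
  obtain u where u: "u i \<in> H" "E (d i) (u i)" "u i \<notin> range d" "\<forall>j<i. \<not> E (u j) (u i)"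
    if "i < n" for i using pendants[of n] by auto
  show False
  proof (rule no_sun[of n d u])
    show "E (d i) (u j) \<longleftrightarrow> i = j" if "i < n" "j < n" for i j
      using unique_attachment[of "u j" i j] u[of j] that by auto
    show "\<not> E (u i) (u j)" if "i < n" "j < n" for i j
      using u(4)[of i] u(4)[of j] that irrefl sym by (metis nat_neq_iff)
  qed (use n_ge_5 cycle_adjacency in auto)
qed

end

lemma (in undominated_level) empty: "H = {}"
proof (rule ccontr)
  assume "H \<noteq> {}"
  define n where "n = (LEAST n. \<exists>w. closed_walk n w)"
  obtain w where "closed_walk n w"
    using LeastI_ex[OF ex_closed_walk[OF \<open>H \<noteq> {}\<close>]] by (auto simp: n_def)
  then interpret shortest_walk E H n w
    by unfold_locales (auto simp: n_def intro: Least_le)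
  show False by (rule contradiction)
qed

section \<open>Five colours for one level\<close>

context spot_sun_free
begin

text \<open>The hypothesis passes to subsets, so by induction either reduction suffices. If neither
  applies, \<open>S\<close> is an \<open>undominated_level\<close> and hence empty.\<close>

lemma colourable_level:
  assumes "finite S" and "\<forall>v\<in>S. \<exists>x p. E x v \<and> E p x \<and> (\<forall>h\<in>S. \<not> E p h)"
  shows "colourable E S 5"
  using assms
proof (induction S rule: finite_psubset_induct)
  case (psubset S)
  have smaller: "colourable E (S - {v}) 5" if "v \<in> S" for v
  proof (rule psubset.IH)
    show "\<forall>y\<in>S - {v}. \<exists>x p. E x y \<and> E p x \<and> (\<forall>h\<in>S - {v}. \<not> E p h)"
    proof
      fix y assume "y \<in> S - {v}"
      then obtain x p where "E x y" "E p x" "\<forall>h\<in>S. \<not> E p h"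
        using psubset.prems by blast
      then show "\<exists>x p. E x y \<and> E p x \<and> (\<forall>h\<in>S - {v}. \<not> E p h)" by blast
    qed
  qed (use that in blast)
  show ?case
  proof (cases "\<exists>v\<in>S. card {w\<in>S. E v w} < 5")
    case True
    then obtain v where "v \<in> S" "card {w\<in>S. E v w} < 5" by blast
    then show ?thesis
      using colourable_low_degree[of E, OF sym irrefl psubset.hyps] smaller by blast
  next
    case deg: False
    show ?thesis
    proof (cases "\<exists>u\<in>S. \<exists>v\<in>S. u \<noteq> v \<and> (\<forall>w\<in>S. E u w \<longrightarrow> E v w)")
      case True
      then obtain u v where "u \<in> S" "v \<in> S" "u \<noteq> v" "\<And>w. w \<in> S \<Longrightarrow> E u w \<Longrightarrow> E v w" by blast
      then show ?thesis
        using colourable_dominated[of E, OF sym irrefl, of u S v 5] smaller[of u] by blast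
    next
      case False
      interpret undominated_level E S
        by unfold_locales (use psubset deg False in \<open>auto simp: not_less\<close>)
      show ?thesis using empty by (simp add: colourable_def)
    qed
  qed
qed

section \<open>Distance levels and the colouring of the whole graph\<close>

text \<open>
  Since \<open>root v\<close> depends only on the set of vertices reachable from \<open>v\<close>, it is constant on
  components.
\<close>

definition edges :: "('a \<times> 'a) set" where
  "edges = {(u, v). E u v}"

definition root :: "'a \<Rightarrow> 'a" where
  "root v = (SOME r. (v, r) \<in> edges\<^sup>*)"

definition level :: "'a \<Rightarrow> nat" where
  "level v = (LEAST n. (root v, v) \<in> edges ^^ n)"

lemma rtrancl_edges_sym: "(u, v) \<in> edges\<^sup>* \<Longrightarrow> (v, u) \<in> edges\<^sup>*"
proof (rule symD[OF sym_rtrancl])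
  show "Relation.sym edges"
    by (rule symI) (use sym_iff in \<open>simp add: edges_def\<close>)
qed

lemma root_eq:
  assumes "E u v"
  shows "root u = root v"
proof -
  have "(u, v) \<in> edges\<^sup>*" "(v, u) \<in> edges\<^sup>*"
    using assms sym[OF assms] by (auto simp: edges_def)
  then have "(u, r) \<in> edges\<^sup>* \<longleftrightarrow> (v, r) \<in> edges\<^sup>*" for r
    by (meson rtrancl_trans)
  then show ?thesis by (simp add: root_def)
qed

lemma relpow_level: "(root v, v) \<in> edges ^^ level v"
proof -
  have "(v, root v) \<in> edges\<^sup>*" unfolding root_def by (rule someI) (rule rtrancl_refl)
  then have "\<exists>n. (root v, v) \<in> edges ^^ n"
    using rtrancl_edges_sym by (auto simp: rtrancl_power)
  then show ?thesis unfolding level_def by (rule LeastI_ex)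
qed

lemma level_le: "(root v, v) \<in> edges ^^ n \<Longrightarrow> level v \<le> n"
  unfolding level_def by (rule Least_le)

lemma level_step:
  assumes "E u v"
  shows "level v \<le> Suc (level u)"
proof (rule level_le)
  show "(root v, v) \<in> edges ^^ Suc (level u)"
    using relpow_level[of u] root_eq[OF assms] assms by (auto simp: edges_def)
qed

text \<open>\<open>x\<close> is the last vertex before \<open>v\<close> on a shortest walk from the
  root.\<close>

lemma level_parent:
  assumes "level v = Suc n"
  shows "\<exists>x. E x v \<and> level x = n"
proof -
  obtain x where x: "(root v, x) \<in> edges ^^ n" "E x v"
    using relpow_Suc_E[OF relpow_level[of v, unfolded assms]] unfolding edges_def by blast
  then have "level x \<le> n" using root_eq[OF x(2)] level_le[of x n] by simp
  moreover have "n \<le> level x" using level_step[OF x(2)] assms by simp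
  ultimately show ?thesis using x by auto
qed

lemma level_0: "level v = 0 \<Longrightarrow> root v = v"
  using relpow_level[of v] by simp

text \<open>Level 0 of a component is just its root, and two adjacent vertices of level 1 would form
  a triangle with it.\<close>

lemma low_levels_independent:
  assumes "level u = level v" "level v \<le> 1"
  shows "\<not> E u v"
proof
  assume e: "E u v"
  show False
  proof (cases "level v = 0")
    case True
    then have "root v = v" "root u = u" using level_0 assms(1) by metis+
    then have "u = v" using root_eq[OF e] by metis
    then show False using e irrefl by blast
  next
    case False
    then have 2: "level u = Suc 0" "level v = Suc 0" using assms by linarith+
    obtain x y where x: "E x u" "level x = 0" and y: "E y v" "level y = 0"
      using level_parent[of u 0] level_parent[of v 0] 2 by auto
    have "x = y"
      using level_0[OF x(2)] level_0[OF y(2)] root_eq[OF e] root_eq[OF x(1)] root_eq[OF y(1)]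
      by metis
    then show False using triangle[OF x(1) e] y(1) by simp
  qed
qed

text \<open>From level 2 on, a grandparent serves as \<open>p\<close>: its neighbours have level at
  most \<open>k - 1\<close>.\<close>

lemma colourable_level_set:
  assumes "finite V"
  shows "colourable E {v\<in>V. level v = k} 5"
proof (cases "k \<le> 1")
  case True
  then show ?thesis
    unfolding colourable_def
    by (intro exI[of _ "\<lambda>_. 0"]) (use low_levels_independent in auto)
next
  case False
  show ?thesis
  proof (rule colourable_level)
    show "\<forall>v\<in>{v\<in>V. level v = k}. \<exists>x p. E x v \<and> E p x \<and> (\<forall>h\<in>{v\<in>V. level v = k}. \<not> E p h)"
    proof
      fix v assume "v \<in> {v\<in>V. level v = k}"
      then have "level v = Suc (Suc (k - 2))" using False by simp
      then obtain x p where x: "E x v" and p: "E p x" "level p = k - 2"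
        using level_parent[of v] level_parent[of _ "k - 2"] by blast
      have "\<not> E p h" if "level h = k" for h
        using level_step[of p h] p that False by auto
      then show "\<exists>x p. E x v \<and> E p x \<and> (\<forall>h\<in>{v\<in>V. level v = k}. \<not> E p h)"
        using x p by blast
    qed
  qed (use assms in simp)
qed

lemma colourable_10:
  assumes "finite V"
  shows "colourable E V 10"
proof -
  have "\<forall>k. \<exists>c. (\<forall>v\<in>{v\<in>V. level v = k}. c v < 5) \<and>
      (\<forall>u\<in>{v\<in>V. level v = k}. \<forall>v\<in>{v\<in>V. level v = k}. E u v \<longrightarrow> c u \<noteq> (c v :: nat))"
    using colourable_level_set[OF assms] by (simp add: colourable_def)
  from choice[OF this] obtain c where c': "\<And>k. (\<forall>v\<in>{v\<in>V. level v = k}. c k v < 5) \<and>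
      (\<forall>u\<in>{v\<in>V. level v = k}. \<forall>v\<in>{v\<in>V. level v = k}. E u v \<longrightarrow> c k u \<noteq> (c k v :: nat))"
    by blast
  then have c: "\<And>v. v \<in> V \<Longrightarrow> c (level v) v < 5"
      "\<And>u v. u \<in> V \<Longrightarrow> v \<in> V \<Longrightarrow> level u = level v \<Longrightarrow> E u v \<Longrightarrow> c (level u) u \<noteq> c (level v) v"
    by auto
  \<comment> \<open>The parity of the level selects the palette 0 to 4 or 5 to 9; edges between
    different levels join opposite parities.\<close>
  define f where "f v = c (level v) v + 5 * (level v mod 2)" for v
  have "f v < 10" if "v \<in> V" for v
    using c(1)[OF that] by (simp add: f_def)
  moreover have "f u \<noteq> f v" if uv: "u \<in> V" "v \<in> V" "E u v" for u v
  proof (cases "level u = level v")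
    case True
    then show ?thesis using c(2)[OF uv(1,2) True uv(3)] by (simp add: f_def)
  next
    case False
    have "level u = Suc (level v) \<or> level v = Suc (level u)" using False level_step[OF uv(3)] level_step[OF sym[OF uv(3)]] by linarith
    then have "level u mod 2 \<noteq> level v mod 2" by (auto simp: mod_Suc split: if_splits)
    then show ?thesis
      using c(1)[OF uv(1)] c(1)[OF uv(2)] unfolding f_def by (cases "level u mod 2 = 0") auto
  qed
  ultimately show ?thesis unfolding colourable_def by blast
qed

end

section \<open>Translating forbidden induced subgraphs into adjacency conditions\<close>

text \<open>The image of \<open>F\<close> is an induced subgraph because \<open>f\<close> both
  preserves and reflects adjacency, and \<open>f\<close> itself is the isomorphism.\<close>

lemma not_induced_free_embedding:
  assumes G: "pair_wf_digraph G" and F: "pair_wf_digraph F" and inj: "inj_on f (pverts F)"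
    and V: "f ` pverts F \<subseteq> pverts G"
    and adj: "\<And>x y. x \<in> pverts F \<Longrightarrow> y \<in> pverts F \<Longrightarrow> (f x, f y) \<in> parcs G \<longleftrightarrow> (x, y) \<in> parcs F"
  shows "\<not> induced_free G F"
proof -
  interpret G: pair_wf_digraph G by (rule G)
  interpret F: pair_wf_digraph F by (rule F)
  define H where "H = \<lparr>pverts = f ` pverts F, parcs = map_prod f f ` parcs F\<rparr>"
  have parcs_H: "parcs H = {e \<in> parcs G. fst e \<in> pverts H \<and> snd e \<in> pverts H}"
  proof (intro set_eqI iffI)
    fix e assume "e \<in> parcs H"
    then obtain x y where "(x, y) \<in> parcs F" "e = (f x, f y)" by (auto simp: H_def)
    then show "e \<in> {e \<in> parcs G. fst e \<in> pverts H \<and> snd e \<in> pverts H}"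
      using adj[of x y] F.wellformed'[of x y] by (auto simp: H_def)
  next
    fix e assume "e \<in> {e \<in> parcs G. fst e \<in> pverts H \<and> snd e \<in> pverts H}"
    then obtain x y where "x \<in> pverts F" "y \<in> pverts F" "e = (f x, f y)" "e \<in> parcs G"
      by (cases e) (auto simp: H_def)
    then show "e \<in> parcs H"
      using adj[of x y] by (auto simp: H_def intro: rev_image_eqI[of "(x, y)"])
  qed
  have H: "pair_wf_digraph H"
    by unfold_locales (auto simp: parcs_H)
  interpret H: pair_wf_digraph H by (rule H)
  define h where "h = \<lparr>iso_verts = f, iso_arcs = map_prod f f, iso_head = snd, iso_tail = fst\<rparr>"
  have "induced_subgraph (with_proj H) (with_proj G)"
    using G.wf_digraph_axioms H.wf_digraph_axioms V parcs_H
    by (auto simp: induced_subgraph_def subgraph_def compatible_def H_def)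
  moreover have "pre_digraph.digraph_isomorphism (with_proj F) h"
  proof -
    have "inj_on (map_prod f f) (parcs F)"
      by (rule inj_on_subset[OF map_prod_inj_on[OF inj inj]]) (auto dest: F.wellformed')
    then show ?thesis
      using inj F.wf_digraph_axioms by (auto simp: pre_digraph.digraph_isomorphism_def h_def)
  qed
  then have "digraph_iso (with_proj F) (with_proj H)"
    unfolding digraph_iso_def
    by (intro exI[of _ h]) (auto simp: h_def H_def app_iso_def with_proj_def)
  then have "digraph_iso (with_proj H) (with_proj F)"
    using digraph_iso_swap F.wf_digraph_axioms by blast
  ultimately show ?thesis unfolding induced_free_def by blast
qed

lemma parcs_sun_simps:
  assumes "i < t" "j < t"
  shows "(Inl i, Inl j) \<in> parcs (sun t) \<longleftrightarrow> j = Suc i mod t \<or> i = Suc j mod t"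
    and "(Inl i, Inr j) \<in> parcs (sun t) \<longleftrightarrow> i = j"
    and "(Inr i, Inl j) \<in> parcs (sun t) \<longleftrightarrow> i = j"
    and "(Inr i, Inr j) \<notin> parcs (sun t)"
  using assms by (auto simp: sun_def Let_def)

lemma pverts_sun: "pverts (sun t) = {..<t} <+> {..<t}"
  by (simp add: sun_def Let_def)

lemma pair_wf_digraph_sun: "pair_wf_digraph (sun t)"
  by unfold_locales (auto simp: sun_def Let_def)

lemma pair_wf_digraph_sunspot: "pair_wf_digraph (sunspot t)"
proof -
  interpret pair_wf_digraph "sun t" by (rule pair_wf_digraph_sun)
  show ?thesis
    by unfold_locales (auto simp: sunspot_def dest: wellformed')
qed

lemma not_sun_free:
  assumes G: "pair_wf_digraph G" and sym: "\<And>u v. (u, v) \<in> parcs G \<Longrightarrow> (v, u) \<in> parcs G"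
    and c: "\<And>i j. i < t \<Longrightarrow> j < t \<Longrightarrow> (c i, c j) \<in> parcs G \<longleftrightarrow> j = Suc i mod t \<or> i = Suc j mod t"
    and cu: "\<And>i j. i < t \<Longrightarrow> j < t \<Longrightarrow> (c i, u j) \<in> parcs G \<longleftrightarrow> i = j"
    and u: "\<And>i j. i < t \<Longrightarrow> j < t \<Longrightarrow> (u i, u j) \<notin> parcs G"
  shows "\<not> sun_free t G"
  unfolding sun_free_def
proof (rule not_induced_free_embedding[OF G pair_wf_digraph_sun])
  interpret pair_wf_digraph G by (rule G)
  have uc: "(u i, c j) \<in> parcs G \<longleftrightarrow> i = j" if "i < t" "j < t" for i j
    using cu[of j i] sym that by blast
  \<comment> \<open>Distinctness follows from adjacency alone: \<open>u i\<close> is adjacent to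
    \<open>c i\<close>, but to no other \<open>c j\<close> and to no \<open>u j\<close>.\<close>
  have "c i = c j \<longleftrightarrow> i = j" "u i = u j \<longleftrightarrow> i = j" "c i \<noteq> u j" "u i \<noteq> c j"
    if "i < t" "j < t" for i j
    using cu[of i i] cu[of j i] cu[of j j] uc[of i i] uc[of j i] u[of j i] u[of i j] that by metis+
  then show "inj_on (case_sum c u) (pverts (sun t))"
    by (auto simp: inj_on_def pverts_sun)
  have "c i \<in> pverts G" "u i \<in> pverts G" if "i < t" for i
    using cu[of i i] that wellformed' by blast+
  then show "case_sum c u ` pverts (sun t) \<subseteq> pverts G"
    by (auto simp: pverts_sun)
  show "(case_sum c u x, case_sum c u y) \<in> parcs G \<longleftrightarrow> (x, y) \<in> parcs (sun t)"
    if "x \<in> pverts (sun t)" "y \<in> pverts (sun t)" for x y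
    using that by (auto simp: pverts_sun parcs_sun_simps c cu uc u)
qed

lemma not_sunspot_free_4:
  assumes G: "pair_graph G" and tri: "triangle_free G"
    and C: "(a, b) \<in> parcs G" "(b, c) \<in> parcs G" "(c, d) \<in> parcs G" "(d, a) \<in> parcs G"
    and p: "(p, a) \<in> parcs G" "(p, c) \<notin> parcs G"
    and q: "(q, c) \<in> parcs G" "(q, a) \<notin> parcs G"
    and r: "(r, b) \<in> parcs G" "(r, d) \<notin> parcs G"
    and pqr: "(p, q) \<notin> parcs G" "(p, r) \<notin> parcs G" "(q, r) \<notin> parcs G"
  shows "\<not> sunspot_free 4 G"
proof -
  interpret pair_graph G by (rule G)
  have sym: "(v, w) \<in> parcs G \<longleftrightarrow> (w, v) \<in> parcs G" for v w
    using arcs_symmetric by blast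
  have irr: "(v, v) \<notin> parcs G" for v using pair_no_loops by force
  have tri: "(v, x) \<notin> parcs G" if "(v, w) \<in> parcs G" "(w, x) \<in> parcs G" for v w x
    using tri that unfolding triangle_free_def by blast
  have nonadj: "(a, c) \<notin> parcs G" "(b, d) \<notin> parcs G" "(p, b) \<notin> parcs G" "(p, d) \<notin> parcs G"
    "(q, b) \<notin> parcs G" "(q, d) \<notin> parcs G" "(r, a) \<notin> parcs G" "(r, c) \<notin> parcs G"
    using tri[of a b c] tri[of b c d] tri[of p a b] tri[of p a d] tri[of q c b] tri[of q c d]
      tri[of r b a] tri[of r b c] C p q r sym by blast+
  define E where "E v w \<longleftrightarrow> (v, w) \<in> parcs G" for v w
  \<comment> \<open>Both orientations of every pair among the seven vertices, so that simplification
    decides each case of the final comparison.\<close>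
  have E: "E a b" "E b a" "E b c" "E c b" "E c d" "E d c" "E d a" "E a d" "E p a" "E a p"
    "E q c" "E c q" "E r b" "E b r" "\<not> E a c" "\<not> E c a" "\<not> E b d" "\<not> E d b" "\<not> E p b" "\<not> E b p"
    "\<not> E p c" "\<not> E c p" "\<not> E p d" "\<not> E d p" "\<not> E q a" "\<not> E a q" "\<not> E q b" "\<not> E b q" "\<not> E q d"
    "\<not> E d q" "\<not> E r a" "\<not> E a r" "\<not> E r c" "\<not> E c r" "\<not> E r d" "\<not> E d r" "\<not> E p q" "\<not> E q p"
    "\<not> E p r" "\<not> E r p" "\<not> E q r" "\<not> E r q" "\<not> E v v" for v
    using C p q r pqr nonadj irr C[THEN sym[THEN iffD1]] p(1)[THEN sym[THEN iffD1]]
      q(1)[THEN sym[THEN iffD1]] r(1)[THEN sym[THEN iffD1]]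
      sym[of c p] sym[of a q] sym[of d r] sym[of q p] sym[of r p] sym[of r q] sym[of c a]
      sym[of d b] sym[of b p] sym[of d p] sym[of b q] sym[of d q] sym[of a r] sym[of c r]
    unfolding E_def by simp_all
  \<comment> \<open>The cycle starts at \<open>d\<close>, which has no pendant, to match the deleted
    \<open>Inr 0\<close>. The \<open>d\<close> in the second list is a filler outside the
    domain.\<close>
  define f where "f = case_sum (nth [d, a, b, c]) (nth [d, p, r, q])"
  have V: "pverts (sunspot 4) = set [Inr 1, Inr 2, Inr 3, Inl 0, Inl 1, Inl 2, Inl 3]"
  proof -
    have "{..<4} = {0, 1, 2, 3 :: nat}" by auto
    then have "pverts (sunspot 4) = {0, 1, 2, 3} <+> {0, 1, 2, 3} - {Inr 0}"
      by (simp only: sunspot_def pverts_sun pair_pre_digraph.simps)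
    then show ?thesis by (simp add: Plus_def insert_Diff_if)
  qed
  have f: "f (Inl 0) = d" "f (Inl (Suc 0)) = a" "f (Inl 2) = b" "f (Inl 3) = c" "f (Inr (Suc 0)) = p"
    "f (Inr 2) = r" "f (Inr 3) = q"
    by (auto simp: f_def)
  have "distinct (map f [Inr 1, Inr 2, Inr 3, Inl 0, Inl 1, Inl 2, Inl 3])"
    using E by (auto simp: f)
  then have inj: "inj_on f (pverts (sunspot 4))"
    unfolding V distinct_map by blast
  show ?thesis
    unfolding sunspot_free_def
  proof (rule not_induced_free_embedding[OF _ pair_wf_digraph_sunspot])
    show "pair_wf_digraph G" by unfold_locales
    show "inj_on f (pverts (sunspot 4))" by (rule inj)
    show "f ` pverts (sunspot 4) \<subseteq> pverts G"
      using C p q r wellformed' unfolding V by (auto simp: f)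
    show "(f x, f y) \<in> parcs G \<longleftrightarrow> (x, y) \<in> parcs (sunspot 4)"
      if "x \<in> pverts (sunspot 4)" "y \<in> pverts (sunspot 4)" for x y
    proof -
      have "(x, y) \<in> parcs (sunspot 4) \<longleftrightarrow> (x, y) \<in> parcs (sun 4)"
        using that by (auto simp: sunspot_def)
      moreover have "E (f x) (f y) \<longleftrightarrow> (x, y) \<in> parcs (sun 4)"
        using that unfolding V list.set by (elim insertE emptyE; hypsubst) (simp_all add: f E parcs_sun_simps)
      ultimately show ?thesis by (simp add: E_def)
    qed
  qed
qed

theorem theorem1p1:
  fixes G :: "'a pair_pre_digraph"
  assumes "pair_graph G"
    and "triangle_free G"
    and "sunspot_free 4 G"
    and "\<And>t. t \<ge> 5 \<Longrightarrow> sun_free t G"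
  shows "chromatic_number G \<le> 47"
proof -
  interpret pair_graph G by (rule assms(1))
  have sym: "(v, u) \<in> parcs G" if "(u, v) \<in> parcs G" for u v
    using that arcs_symmetric by blast
  have wf: "pair_wf_digraph G" by unfold_locales
  interpret spot_sun_free "\<lambda>u v. (u, v) \<in> parcs G"
  proof unfold_locales
    show "(u, w) \<notin> parcs G" if "(u, v) \<in> parcs G" "(v, w) \<in> parcs G" for u v w
      using assms(2) that unfolding triangle_free_def by blast
    show "(p, q) \<in> parcs G \<or> (p, r) \<in> parcs G \<or> (q, r) \<in> parcs G"
      if "(a, b) \<in> parcs G" "(b, c) \<in> parcs G" "(c, d) \<in> parcs G" "(d, a) \<in> parcs G"
        "(p, a) \<in> parcs G" "(p, c) \<notin> parcs G" "(q, c) \<in> parcs G" "(q, a) \<notin> parcs G"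
        "(r, b) \<in> parcs G" "(r, d) \<notin> parcs G" for a b c d p q r
      using not_sunspot_free_4[OF assms(1,2) that] assms(3) by blast
    show False if "5 \<le> n"
      "\<And>i j. i < n \<Longrightarrow> j < n \<Longrightarrow> (c i, c j) \<in> parcs G \<longleftrightarrow> j = Suc i mod n \<or> i = Suc j mod n"
      "\<And>i j. i < n \<Longrightarrow> j < n \<Longrightarrow> (c i, u j) \<in> parcs G \<longleftrightarrow> i = j"
      "\<And>i j. i < n \<Longrightarrow> j < n \<Longrightarrow> (u i, u j) \<notin> parcs G" for n :: nat and c u
      using not_sun_free[OF wf sym that(2-4)] assms(4)[OF that(1)] by blast
  qed (rule sym)
  obtain f where "\<forall>v\<in>pverts G. f v < 10"
      "\<forall>u\<in>pverts G. \<forall>v\<in>pverts G. (u, v) \<in> parcs G \<longrightarrow> f u \<noteq> (f v :: nat)"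
    using colourable_10[OF pair_finite_verts] unfolding colourable_def by blast
  then have "proper_coloring G 10 f"
    unfolding proper_coloring_def using wellformed' by blast
  then have "chromatic_number G \<le> 10"
    unfolding chromatic_number_def by (intro Least_le) blast
  then show ?thesis by simp
qed

end
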